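(* Let $\mathfrak g$ be a Leibniz algebra and $\mathfrak{Der}(\mathfrak g)=\mathrm{Der}^L(\mathfrak g)\oplus\mathrm{Der}^R(\mathfrak g)$. Then $(\mathfrak{Der}(\mathfrak g),[\cdot,\cdot]_s)$ is a Leibniz algebra, where the bracket operation $[\cdot,\cdot]_s$ is given by $$[(D^L_1,D^R_1),(D^L_2,D^R_2)]_s=([D^L_1,D^L_2],[D^L_1,D^R_2]),\quad\forall D^L_i\in\mathrm{Der}^L(\mathfrak g),\ D^R_i\in\mathrm{Der}^R(\mathfrak g).$$
   Context: All vector spaces are over a fixed ground field. A (left) Leibniz algebra is a vector space with a bilinear bracket satisfying $[x,[y,z]]=[[x,y],z]+[y,[x,z]]$. $\mathrm{Der}^L(\mathfrak g)=\{D\in\mathfrak{gl}(\mathfrak g): D[x,y]_{\mathfrak g}=[Dx,y]_{\mathfrak g}+[x,Dy]_{\mathfrak g}\ \forall x,y\}$ (left derivations), $\mathrm{Der}^R(\mathfrak g)=\{D\in\mathfrak{gl}(\mathfrak g): D[x,y]_{\mathfrak g}=[x,Dy]_{\mathfrak g}-[y,Dx]_{\mathfrak g}\ \forall x,y\}$ (right derivations). On $\mathfrak{gl}(\mathfrak g)$, $[D_1,D_2]=D_1D_2-D_2D_1$. *)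

theory Defs
  imports Complex_Main "HOL-Library.Function_Algebras" "HOL-Library.Product_Plus"
begin

text \<open>
  A left Leibniz algebra whose underlying vector space is a subspace \<open>S\<close> of an ambient
  vector space; the bracket is only constrained on \<open>S\<close>.  A subspace is needed
  because spaces of derivations are proper subspaces of function types;
  an abstract Leibniz algebra is the case \<open>S = UNIV\<close>.
\<close>

locale leibniz_algebra = vector_space scale
  for scale :: "'k::field \<Rightarrow> 'v::ab_group_add \<Rightarrow> 'v" +
  fixes S :: "'v set" and br :: "'v \<Rightarrow> 'v \<Rightarrow> 'v"
  assumes subspace_carrier: "subspace S"
    and br_closed: "\<lbrakk>x \<in> S; y \<in> S\<rbrakk> \<Longrightarrow> br x y \<in> S"
    and br_add_left: "\<lbrakk>x \<in> S; y \<in> S; z \<in> S\<rbrakk> \<Longrightarrow> br (x + y) z = br x z + br y z"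
    and br_add_right: "\<lbrakk>x \<in> S; y \<in> S; z \<in> S\<rbrakk> \<Longrightarrow> br x (y + z) = br x y + br x z"
    and br_scale_left: "\<lbrakk>x \<in> S; y \<in> S\<rbrakk> \<Longrightarrow> br (scale c x) y = scale c (br x y)"
    and br_scale_right: "\<lbrakk>x \<in> S; y \<in> S\<rbrakk> \<Longrightarrow> br x (scale c y) = scale c (br x y)"
    and leibniz: "\<lbrakk>x \<in> S; y \<in> S; z \<in> S\<rbrakk> \<Longrightarrow> br x (br y z) = br (br x y) z + br y (br x z)"

definition gl :: "('k::field \<Rightarrow> 'v::ab_group_add \<Rightarrow> 'v) \<Rightarrow> ('v \<Rightarrow> 'v) set" where
  "gl scale = {D. Vector_Spaces.linear scale scale D}"

definition DerL :: "('k::field \<Rightarrow> 'v::ab_group_add \<Rightarrow> 'v) \<Rightarrow> ('v \<Rightarrow> 'v \<Rightarrow> 'v) \<Rightarrow> ('v \<Rightarrow> 'v) set" where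
  "DerL scale br = {D \<in> gl scale. \<forall>x y. D (br x y) = br (D x) y + br x (D y)}"

definition DerR :: "('k::field \<Rightarrow> 'v::ab_group_add \<Rightarrow> 'v) \<Rightarrow> ('v \<Rightarrow> 'v \<Rightarrow> 'v) \<Rightarrow> ('v \<Rightarrow> 'v) set" where
  "DerR scale br = {D \<in> gl scale. \<forall>x y. D (br x y) = br x (D y) - br y (D x)}"

text \<open>
  The direct sum is external: the Cartesian product, with componentwise operations
  (addition of functions and of pairs comes from the type class instances).
\<close>

definition Der ::
  "('k::field \<Rightarrow> 'v::ab_group_add \<Rightarrow> 'v) \<Rightarrow> ('v \<Rightarrow> 'v \<Rightarrow> 'v) \<Rightarrow> (('v \<Rightarrow> 'v) \<times> ('v \<Rightarrow> 'v)) set" where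
  "Der scale br = DerL scale br \<times> DerR scale br"

definition fun_scale :: "('k \<Rightarrow> 'v \<Rightarrow> 'v) \<Rightarrow> 'k \<Rightarrow> ('v \<Rightarrow> 'v) \<Rightarrow> ('v \<Rightarrow> 'v)" where
  "fun_scale scale c D = (\<lambda>x. scale c (D x))"

definition pair_scale ::
  "('k \<Rightarrow> 'v \<Rightarrow> 'v) \<Rightarrow> 'k \<Rightarrow> ('v \<Rightarrow> 'v) \<times> ('v \<Rightarrow> 'v) \<Rightarrow> ('v \<Rightarrow> 'v) \<times> ('v \<Rightarrow> 'v)" where
  "pair_scale scale c P = (fun_scale scale c (fst P), fun_scale scale c (snd P))"

definition commutator :: "('v::ab_group_add \<Rightarrow> 'v) \<Rightarrow> ('v \<Rightarrow> 'v) \<Rightarrow> ('v \<Rightarrow> 'v)" where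
  "commutator D1 D2 = (D1 \<circ> D2) - (D2 \<circ> D1)"

fun bracket_s ::
  "('v::ab_group_add \<Rightarrow> 'v) \<times> ('v \<Rightarrow> 'v) \<Rightarrow> ('v \<Rightarrow> 'v) \<times> ('v \<Rightarrow> 'v) \<Rightarrow> ('v \<Rightarrow> 'v) \<times> ('v \<Rightarrow> 'v)" where
  "bracket_s (DL1, DR1) (DL2, DR2) = (commutator DL1 DL2, commutator DL1 DR2)"

end

theory Submission
  imports Defs
begin

text \<open>
  The bracket \<open>[\<cdot>,\<cdot>]\<^sub>s\<close> is a hemisemidirect product.  Under the commutator, left derivations
  are closed, so they form a Lie algebra; and the commutator of a left derivation with a right
  derivation is again a right derivation, so this Lie algebra acts on the right derivations.  For
  any Lie algebra \<open>L\<close> acting on a vector space \<open>V\<close>, the bracket \<open>[(a, v), (b, w)] = ([a, b], a \<cdot> w)\<close>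
  on \<open>L \<oplus> V\<close> is a left Leibniz bracket.  The first component of the Leibniz identity is the Jacobi
  identity of \<open>L\<close>; the second, \<open>a \<cdot> (b \<cdot> w) = [a, b] \<cdot> w + b \<cdot> (a \<cdot> w)\<close>, is the axiom of an action.
  Here the action is itself given by commutators, so both components are instances of the
  single identity \<open>commutator_leibniz\<close> for linear maps.

  The mathematical content is therefore in the two closure statements
  \<open>commutator_in_DerL\<close> and \<open>commutator_DerL_DerR\<close>.  The remaining axioms say that the derivations
  form subspaces of the function space and that the commutator is bilinear.
\<close>

section \<open>The commutator on linear maps\<close>

lemma gl_iff:
  assumes "vector_space scale"
  shows "D \<in> gl scale \<longleftrightarrow>
    (\<forall>x y. D (x + y) = D x + D y) \<and> (\<forall>c x. D (scale c x) = scale c (D x))"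
  using assms by (simp add: gl_def Vector_Spaces.linear_iff)

lemma gl_add: "D \<in> gl scale \<Longrightarrow> D (x + y) = D x + D y"
  and gl_scale: "D \<in> gl scale \<Longrightarrow> D (scale c x) = scale c (D x)"
  by (simp_all add: gl_def Vector_Spaces.linear_iff)

lemma gl_diff:
  fixes scale :: "'k::field \<Rightarrow> 'v::ab_group_add \<Rightarrow> 'v"
  assumes "D \<in> gl scale"
  shows "D (x - y) = D x - D y"
  using gl_add[OF assms, of "x - y" y] by (simp add: algebra_simps)

lemma commutator_apply: "commutator D1 D2 x = D1 (D2 x) - D2 (D1 x)"
  by (simp add: commutator_def)

lemma commutator_in_gl:
  assumes "vector_space scale" "D1 \<in> gl scale" "D2 \<in> gl scale"
  shows "commutator D1 D2 \<in> gl scale"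
proof -
  interpret vector_space scale by fact
  show ?thesis
    using assms(2,3)
    by (simp add: gl_iff[OF assms(1)] commutator_apply scale_right_diff_distrib)
qed

text \<open>
  The Jacobi identity, arranged to say that \<open>commutator D1\<close> is a derivation of the commutator.
\<close>
lemma commutator_leibniz:
  fixes scale :: "'k::field \<Rightarrow> 'v::ab_group_add \<Rightarrow> 'v"
  assumes "D1 \<in> gl scale" "D2 \<in> gl scale" "D3 \<in> gl scale"
  shows "commutator D1 (commutator D2 D3) =
    commutator (commutator D1 D2) D3 + commutator D2 (commutator D1 D3)"
  by (intro ext) (simp add: commutator_apply assms[THEN gl_diff])

lemma commutator_add_left:
  fixes scale :: "'k::field \<Rightarrow> 'v::ab_group_add \<Rightarrow> 'v"
  assumes "D3 \<in> gl scale"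
  shows "commutator (D1 + D2) D3 = commutator D1 D3 + commutator D2 D3"
  by (intro ext) (simp add: commutator_apply gl_add[OF assms])

lemma commutator_add_right:
  fixes scale :: "'k::field \<Rightarrow> 'v::ab_group_add \<Rightarrow> 'v"
  assumes "D1 \<in> gl scale"
  shows "commutator D1 (D2 + D3) = commutator D1 D2 + commutator D1 D3"
  by (intro ext) (simp add: commutator_apply gl_add[OF assms])

lemma commutator_scale_left:
  assumes "vector_space scale" "D2 \<in> gl scale"
  shows "commutator (fun_scale scale c D1) D2 = fun_scale scale c (commutator D1 D2)"
proof -
  interpret vector_space scale by fact
  show ?thesis
    by (intro ext)
      (simp add: commutator_apply fun_scale_def gl_scale[OF assms(2)] scale_right_diff_distrib)
qed

lemma commutator_scale_right:
  assumes "vector_space scale" "D1 \<in> gl scale"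
  shows "commutator D1 (fun_scale scale c D2) = fun_scale scale c (commutator D1 D2)"
proof -
  interpret vector_space scale by fact
  show ?thesis
    by (intro ext)
      (simp add: commutator_apply fun_scale_def gl_scale[OF assms(2)] scale_right_diff_distrib)
qed

section \<open>Left and right derivations of a bilinear product\<close>

lemma DerL_gl: "D \<in> DerL scale br \<Longrightarrow> D \<in> gl scale"
  and DerL_br: "D \<in> DerL scale br \<Longrightarrow> D (br x y) = br (D x) y + br x (D y)"
  by (simp_all add: DerL_def)

lemma DerR_gl: "D \<in> DerR scale br \<Longrightarrow> D \<in> gl scale"
  and DerR_br: "D \<in> DerR scale br \<Longrightarrow> D (br x y) = br x (D y) - br y (D x)"
  by (simp_all add: DerR_def)

locale bilinear_product = vector_space scale
  for scale :: "'k::field \<Rightarrow> 'v::ab_group_add \<Rightarrow> 'v" +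
  fixes br :: "'v \<Rightarrow> 'v \<Rightarrow> 'v"
  assumes add_left: "br (x + y) z = br x z + br y z"
    and add_right: "br x (y + z) = br x y + br x z"
    and scale_left: "br (scale c x) y = scale c (br x y)"
    and scale_right: "br x (scale c y) = scale c (br x y)"
begin

lemma zero_left: "br 0 y = 0"
  using add_left[of 0 0 y] by simp

lemma zero_right: "br x 0 = 0"
  using add_right[of x 0 0] by simp

lemma diff_left: "br (x - y) z = br x z - br y z"
  using add_left[of "x - y" y z] by (simp add: algebra_simps)

lemma diff_right: "br x (y - z) = br x y - br x z"
  using add_right[of x "y - z" z] by (simp add: algebra_simps)

lemma vs: "vector_space scale" ..

lemma DerL_zero: "0 \<in> DerL scale br"
  by (simp add: DerL_def gl_iff[OF vs] zero_left zero_right)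

lemma DerL_add: "D1 \<in> DerL scale br \<Longrightarrow> D2 \<in> DerL scale br \<Longrightarrow> D1 + D2 \<in> DerL scale br"
  by (simp add: DerL_def gl_iff[OF vs] add_left add_right scale_right_distrib algebra_simps)

lemma DerL_scale: "D \<in> DerL scale br \<Longrightarrow> fun_scale scale c D \<in> DerL scale br"
  by (simp add: DerL_def gl_iff[OF vs] fun_scale_def scale_left scale_right
      scale_right_distrib scale_left_commute)

lemma DerR_zero: "0 \<in> DerR scale br"
  by (simp add: DerR_def gl_iff[OF vs] zero_right)

lemma DerR_add: "D1 \<in> DerR scale br \<Longrightarrow> D2 \<in> DerR scale br \<Longrightarrow> D1 + D2 \<in> DerR scale br"
  by (simp add: DerR_def gl_iff[OF vs] add_right scale_right_distrib algebra_simps)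

lemma DerR_scale: "D \<in> DerR scale br \<Longrightarrow> fun_scale scale c D \<in> DerR scale br"
  by (simp add: DerR_def gl_iff[OF vs] fun_scale_def scale_right
      scale_right_distrib scale_right_diff_distrib scale_left_commute)

text \<open>
  In \<open>D1 (D2 (br x y))\<close> the mixed terms \<open>br (D1 x) (D2 y) + br (D2 x) (D1 y)\<close> are symmetric in
  \<open>D1\<close> and \<open>D2\<close>, so they cancel in the commutator.
\<close>
lemma commutator_in_DerL:
  assumes "D1 \<in> DerL scale br" "D2 \<in> DerL scale br"
  shows "commutator D1 D2 \<in> DerL scale br"
proof -
  have "commutator D1 D2 (br x y) = br (commutator D1 D2 x) y + br x (commutator D1 D2 y)" for x y
    by (simp add: commutator_apply assms[THEN DerL_br] assms[THEN DerL_gl, THEN gl_add]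
        diff_left diff_right)
  then show ?thesis
    using commutator_in_gl[OF vs DerL_gl DerL_gl, OF assms] by (simp add: DerL_def)
qed

text \<open>
  Both \<open>D (R (br x y))\<close> and \<open>R (D (br x y))\<close> have the mixed terms
  \<open>br (D x) (R y) - br (D y) (R x)\<close>, and these cancel; what is left has \<open>commutator D R\<close> in the
  second argument only, as the rule for right derivations requires.
\<close>
lemma commutator_DerL_DerR:
  assumes "D \<in> DerL scale br" "R \<in> DerR scale br"
  shows "commutator D R \<in> DerR scale br"
proof -
  have "commutator D R (br x y) = br x (commutator D R y) - br y (commutator D R x)" for x y
    by (simp add: commutator_apply DerL_br[OF assms(1)] DerR_br[OF assms(2)]
        gl_add[OF DerR_gl, OF assms(2)] gl_diff[OF DerL_gl, OF assms(1)] diff_right)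
  then show ?thesis
    using commutator_in_gl[OF vs DerL_gl DerR_gl, OF assms] by (simp add: DerR_def)
qed

end

lemma (in leibniz_algebra) bilinear_product_of_UNIV:
  assumes "S = UNIV"
  shows "bilinear_product scale br"
  using assms
  by unfold_locales (simp_all add: br_add_left br_add_right br_scale_left br_scale_right)

section \<open>The Leibniz algebra of derivations\<close>

lemma vector_space_pair_scale:
  assumes "vector_space scale"
  shows "vector_space (pair_scale scale)"
proof -
  interpret vector_space scale by fact
  show ?thesis
    by unfold_locales
      (auto simp: pair_scale_def fun_scale_def prod_eq_iff fun_eq_iff
        scale_right_distrib scale_left_distrib)
qed

theorem lemma2p4:
  fixes scale :: "'k::field \<Rightarrow> 'v::ab_group_add \<Rightarrow> 'v"
    and br :: "'v \<Rightarrow> 'v \<Rightarrow> 'v"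
  assumes "leibniz_algebra scale UNIV br"
  shows "leibniz_algebra (pair_scale scale) (Der scale br) bracket_s"
proof -
  interpret bilinear_product scale br
    using assms by (rule leibniz_algebra.bilinear_product_of_UNIV) simp
  interpret P: vector_space "pair_scale scale"
    by (rule vector_space_pair_scale[OF vs])
  show ?thesis
  proof
    show "P.subspace (Der scale br)"
      by (rule P.subspaceI)
        (auto simp: Der_def pair_scale_def zero_prod_def
          DerL_zero DerR_zero DerL_add DerR_add DerL_scale DerR_scale)
  next
    fix P Q T c
    assume P: "P \<in> Der scale br" and Q: "Q \<in> Der scale br"
    then obtain D1 R1 D2 R2 where PQ: "P = (D1, R1)" "Q = (D2, R2)"
      and D: "D1 \<in> DerL scale br" "D2 \<in> DerL scale br"
      and R: "R1 \<in> DerR scale br" "R2 \<in> DerR scale br"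
      by (auto simp: Der_def)
    show "bracket_s P Q \<in> Der scale br"
      using D R by (simp add: PQ Der_def commutator_in_DerL commutator_DerL_DerR)
    note gl12 = D[THEN DerL_gl] R[THEN DerR_gl]
    show "bracket_s (pair_scale scale c P) Q = pair_scale scale c (bracket_s P Q)"
      by (simp add: PQ pair_scale_def gl12[THEN commutator_scale_left[OF vs]])
    show "bracket_s P (pair_scale scale c Q) = pair_scale scale c (bracket_s P Q)"
      by (simp add: PQ pair_scale_def gl12[THEN commutator_scale_right[OF vs]])
    assume "T \<in> Der scale br"
    then obtain D3 R3 where T: "T = (D3, R3)"
      and D3: "D3 \<in> DerL scale br" and R3: "R3 \<in> DerR scale br"
      by (auto simp: Der_def)
    note gl = gl12 D3[THEN DerL_gl] R3[THEN DerR_gl]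
    show "bracket_s (P + Q) T = bracket_s P T + bracket_s Q T"
      by (simp add: PQ T gl[THEN commutator_add_left])
    show "bracket_s P (Q + T) = bracket_s P Q + bracket_s P T"
      by (simp add: PQ T gl[THEN commutator_add_right])
    show "bracket_s P (bracket_s Q T) = bracket_s (bracket_s P Q) T + bracket_s Q (bracket_s P T)"
      by (simp add: PQ T commutator_leibniz[OF gl(1,2,5)] commutator_leibniz[OF gl(1,2,6)])
  qed
qed

end
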